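(* For every finite poset $P$ there is a finite sequence of posets $P=P_0,P_1,\dots,P_k$ with $P_k$ the empty poset such that each $P_{i+1}$ is obtained from $P_i$ either by a deletion (i.e. $P_{i+1}=P_i\setminus\{b\}$ for a removable element $b$ of $P_i$) or by a partially linear extension (i.e. $P_{i+1}=P_i(M,A)$ for some anti-chain $A$ of $P_i$ and nonempty $M\subseteq A$).
   Context: An element $b$ of a poset is removable if it covers at most one element and is covered by at most one element; $P\setminus\{b\}$ is the induced subposet. Partially linear extension: given an anti-chain $A$ of $P$ and a nonempty $M\subseteq A$, $P(M,A)$ is the poset on $(P\setminus M)\cup\{M\}$ (the elements of $M$ glued into one new element $M$) with $x\le y$ iff one of: (a) $x,y\in P\setminus M$ and $x\le_P y$; (b) $x,y\in P\setminus M$ and there exist $x'\in A$, $y'\in M$ with $x\le_P x'$ and $y'\le_P y$; (c) $x=M$ and some $y'\in M$ has $y'\le_P y$; (d) $y=M$ and some $x'\in A$ has $x\le_P x'$; (e) $x=y=M$. *)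

theory Defs
  imports Main "HOL-Library.FSet"
begin

text \<open>A poset is represented, as in theory Order_Relation, by its order relation \<open>r\<close> alone:
  \<open>Partial_order r\<close> says that \<open>r\<close> is a partial order on the carrier \<open>Field r\<close>
  (reflexivity makes the carrier recoverable from \<open>r\<close>). The empty poset is the empty relation.\<close>

definition covers :: "'a rel \<Rightarrow> 'a \<Rightarrow> 'a \<Rightarrow> bool" where
  "covers r y x \<longleftrightarrow> (x, y) \<in> r \<and> x \<noteq> y \<and>
     (\<forall>z. (x, z) \<in> r \<and> (z, y) \<in> r \<longrightarrow> z = x \<or> z = y)"

definition removable :: "'a rel \<Rightarrow> 'a \<Rightarrow> bool" where
  "removable r b \<longleftrightarrow> b \<in> Field r \<and>
     (\<exists>\<^sub>\<le>\<^sub>1 x. covers r b x) \<and> (\<exists>\<^sub>\<le>\<^sub>1 y. covers r y b)"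

definition delete :: "'a rel \<Rightarrow> 'a \<Rightarrow> 'a rel" where
  "delete r b = Restr r (Field r - {b})"

definition antichain :: "'a rel \<Rightarrow> 'a set \<Rightarrow> bool" where
  "antichain r A \<longleftrightarrow> A \<subseteq> Field r \<and> (\<forall>x\<in>A. \<forall>y\<in>A. (x, y) \<in> r \<longrightarrow> x = y)"

text \<open>In \<open>P(M,A)\<close> the set \<open>M\<close> of elements of \<open>P\<close> is itself an element, and this may be iterated.
  Hence elements are either original elements of the initial poset, or finite sets of elements.\<close>

datatype 'a elt = Orig 'a | Glued "'a elt fset"

text \<open>The relation of \<open>P(M,A)\<close>. The five components are the clauses (a)--(e), in this order;
  \<open>Q\<close> is \<open>P \<setminus> M\<close>, and \<open>Glued M\<close> is the new element \<open>M\<close>.\<close>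

definition partially_linear_ext :: "'a elt rel \<Rightarrow> 'a elt fset \<Rightarrow> 'a elt set \<Rightarrow> 'a elt rel" where
  "partially_linear_ext r M A =
     (let Q = Field r - fset M in
        {(x, y). x \<in> Q \<and> y \<in> Q \<and> (x, y) \<in> r}
      \<union> {(x, y). x \<in> Q \<and> y \<in> Q \<and> (\<exists>x'\<in>A. \<exists>y'\<in>fset M. (x, x') \<in> r \<and> (y', y) \<in> r)}
      \<union> {(x, y). x = Glued M \<and> y \<in> Q \<and> (\<exists>y'\<in>fset M. (y', y) \<in> r)}
      \<union> {(x, y). x \<in> Q \<and> y = Glued M \<and> (\<exists>x'\<in>A. (x, x') \<in> r)}
      \<union> {(Glued M, Glued M)})"

definition deletion_step :: "'a rel \<Rightarrow> 'a rel \<Rightarrow> bool" where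
  "deletion_step r s \<longleftrightarrow> (\<exists>b. removable r b \<and> s = delete r b)"

text \<open>The condition \<open>Glued M \<notin> Field r\<close> expresses that the element \<open>M\<close> is new, i.e. that the
  union \<open>(P \<setminus> M) \<union> {M}\<close> is disjoint. It holds automatically in every poset reached from one
  consisting of original elements only.\<close>

definition ple_step :: "'a elt rel \<Rightarrow> 'a elt rel \<Rightarrow> bool" where
  "ple_step r s \<longleftrightarrow>
     (\<exists>A M. antichain r A \<and> M \<noteq> {||} \<and> fset M \<subseteq> A \<and> Glued M \<notin> Field r \<and>
            s = partially_linear_ext r M A)"

text \<open>A poset over an arbitrary type, regarded as a poset of original elements.\<close>

definition orig_poset :: "'a rel \<Rightarrow> 'a elt rel" where
  "orig_poset r = map_prod Orig Orig ` r"

lemma Field_delete: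
  assumes "Partial_order r"
  shows "Field (delete r b) = Field r - {b}"
proof -
  have "Refl r"
    using assms by (rule partial_order_onD)
  then show ?thesis
    unfolding delete_def by (simp add: Refl_Field_Restr2)
qed

lemma Partial_order_delete:
  assumes "Partial_order r"
  shows "Partial_order (delete r b)"
  unfolding delete_def by (rule Partial_order_Restr[OF assms])

lemma Field_partially_linear_ext:
  assumes "Partial_order r"
  shows "Field (partially_linear_ext r M A) = (Field r - fset M) \<union> {Glued M}" (is "Field ?s = ?C")
proof
  show "Field ?s \<subseteq> ?C"
    unfolding partially_linear_ext_def Let_def Field_def by auto
  have "(x, x) \<in> r" if "x \<in> Field r" for x
    using partial_order_onD(1)[OF assms] that by (rule refl_onD)
  then have "(x, x) \<in> ?s" if "x \<in> ?C" for x
    using that unfolding partially_linear_ext_def Let_def by auto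
  then show "?C \<subseteq> Field ?s"
    by (auto intro: FieldI1)
qed

lemma Partial_order_partially_linear_ext:
  assumes "Partial_order r" "antichain r A" "fset M \<subseteq> A" "Glued M \<notin> Field r"
  shows "Partial_order (partially_linear_ext r M A)"
proof -
  let ?s = "partially_linear_ext r M A"
  define Q where "Q = Field r - fset M"
  define up where "up x \<longleftrightarrow> (\<exists>a\<in>A. (x, a) \<in> r)" for x
  define dn where "dn y \<longleftrightarrow> (\<exists>m\<in>fset M. (m, y) \<in> r)" for y
  note po = partial_order_onD[OF assms(1)]
  have rf: "(x, x) \<in> r" if "x \<in> Q" for x
    using refl_onD[OF po(1)] that unfolding Q_def by blast
  have tr: "(x, z) \<in> r" if "(x, y) \<in> r" "(y, z) \<in> r" for x y z
    using po(2) that by (rule transD)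
  have an: "x = y" if "(x, y) \<in> r" "(y, x) \<in> r" for x y
    using po(3) that by (rule antisymD)
  have G: "Glued M \<notin> Q"
    using assms(4) unfolding Q_def by blast
  have key: False if x: "x \<in> Q" and d: "dn x" and u: "up x" for x
  proof -
    obtain m a where ma: "m \<in> fset M" "(m, x) \<in> r" "a \<in> A" "(x, a) \<in> r"
      using d u unfolding dn_def up_def by blast
    have "(m, a) \<in> r"
      using ma(2,4) by (rule tr)
    then have "m = a"
      using ma(1,3) assms(2,3) unfolding antichain_def by blast
    then have "x = m"
      using ma(2,4) an by blast
    then show False
      using ma(1) x unfolding Q_def by blast
  qed
  have upr: "up x" if "(x, y) \<in> r" "up y" for x y
    using that tr unfolding up_def by blast
  have dnr: "dn y" if "(x, y) \<in> r" "dn x" for x y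
    using that tr unfolding dn_def by blast
  have mem: "(x, y) \<in> ?s \<longleftrightarrow>
      x \<in> Q \<and> y \<in> Q \<and> ((x, y) \<in> r \<or> up x \<and> dn y) \<or>
      x = Glued M \<and> y \<in> Q \<and> dn y \<or>
      x \<in> Q \<and> y = Glued M \<and> up x \<or>
      x = Glued M \<and> y = Glued M" for x y
    unfolding partially_linear_ext_def Let_def Q_def up_def dn_def by auto
  have "trans ?s"
  proof (rule transI)
    fix x y z assume "(x, y) \<in> ?s" "(y, z) \<in> ?s"
    then show "(x, z) \<in> ?s"
      unfolding mem using G key upr dnr tr by metis
  qed
  moreover have "antisym ?s"
  proof (rule antisymI)
    fix x y assume "(x, y) \<in> ?s" "(y, x) \<in> ?s"
    then show "x = y"
      unfolding mem using G key upr dnr an by metis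
  qed
  moreover have "refl_on (Field ?s) ?s"
    unfolding Field_partially_linear_ext[OF assms(1)] Q_def[symmetric]
    by (rule refl_onI) (auto simp: mem rf)
  moreover have "?s \<subseteq> Field ?s \<times> Field ?s"
    by (auto intro: FieldI1 FieldI2)
  ultimately show ?thesis
    unfolding partial_order_on_def preorder_on_def by simp
qed

end

theory Submission
  imports Defs
begin

text \<open>If two elements of the poset are incomparable, gluing them (\<open>M = A\<close>) lowers the number of
  elements by one; otherwise the poset is a chain, in which every element is removable. Both moves
  can be repeated until nothing is left. Glued elements are always new because, at every stage,
  distinct elements are built from disjoint nonempty sets of original elements.\<close>

primrec leaves :: "'a elt \<Rightarrow> 'a set" where
  "leaves (Orig a) = {a}"
| "leaves (Glued M) = \<Union> (fset (leaves |`| M))"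

definition separated :: "'a elt set \<Rightarrow> bool" where
  "separated X \<longleftrightarrow> (\<forall>x\<in>X. leaves x \<noteq> {}) \<and> (\<forall>x\<in>X. \<forall>y\<in>X. leaves x \<inter> leaves y \<noteq> {} \<longrightarrow> x = y)"

lemma separated_subset: "separated X \<Longrightarrow> Y \<subseteq> X \<Longrightarrow> separated Y"
  unfolding separated_def by blast

lemma separated_Orig: "separated (Orig ` X)"
  unfolding separated_def by auto

text \<open>The leaves of \<open>Glued M\<close> are the union of the leaves of the members of
  \<open>M\<close>, so they stay disjoint from those of every element left outside
  \<open>M\<close>.\<close>

lemma separated_Glued:
  assumes "separated X" "fset M \<subseteq> X" "M \<noteq> {||}"
  shows "separated ((X - fset M) \<union> {Glued M})"
proof -
  have disj: "leaves x \<inter> leaves (Glued M) = {}" if "x \<in> X - fset M" for x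
    using assms(1,2) that unfolding separated_def by fastforce
  obtain m where "m |\<in>| M"
    using assms(3) by blast
  moreover from this have "leaves m \<noteq> {}"
    using assms(1,2) unfolding separated_def by blast
  ultimately have "leaves (Glued M) \<noteq> {}"
    by auto
  then show ?thesis
    using assms(1) disj unfolding separated_def by (simp del: leaves.simps) blast
qed

text \<open>If \<open>Glued M\<close> were in \<open>X\<close>, each member of \<open>M\<close> in
  \<open>X\<close> would share its nonempty leaves with \<open>Glued M\<close> and hence equal it.
  Two distinct members make this absurd.\<close>

lemma Glued_notin_separated:
  assumes "separated X" "a \<in> X" "b \<in> X" "a \<noteq> b" "a |\<in>| M" "b |\<in>| M"
  shows "Glued M \<notin> X"
proof
  assume G: "Glued M \<in> X"
  have "x = Glued M" if "x \<in> X" "x |\<in>| M" for x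
  proof -
    have "leaves x \<subseteq> leaves (Glued M)"
      using that by auto
    then show ?thesis
      using assms(1) that G unfolding separated_def by (metis inf.absorb1)
  qed
  then show False
    using assms by blast
qed

text \<open>Of two distinct elements covered by \<open>b\<close>, comparability would put the larger
  strictly between the smaller and \<open>b\<close>. The argument for upper covers is dual.\<close>

lemma removable_if_total:
  assumes "Total r" "antisym r" "b \<in> Field r"
  shows "removable r b"
proof -
  have comparable: "(x, y) \<in> r \<or> (y, x) \<in> r"
    if "x \<in> Field r" "y \<in> Field r" "x \<noteq> y" for x y
    using assms(1) that unfolding total_on_def by blast
  have "x = y" if "covers r b x" "covers r b y" for x y
    using that comparable[of x y] unfolding covers_def by (metis FieldI1)
  moreover have "x = y" if "covers r x b" "covers r y b" for x y
    using that comparable[of x y] unfolding covers_def by (metis FieldI2)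
  ultimately show ?thesis
    using assms(3) unfolding removable_def Uniq_def by blast
qed

text \<open>Recording that the target is a partial order lets this property be read off any chain of
  steps.\<close>

definition poset_step :: "'a elt rel \<Rightarrow> 'a elt rel \<Rightarrow> bool" where
  "poset_step r s \<longleftrightarrow> Partial_order s \<and> (deletion_step r s \<or> ple_step r s)"

lemma poset_step_decreasing:
  assumes "Partial_order r" "finite (Field r)" "separated (Field r)" "Field r \<noteq> {}"
  obtains s where "poset_step r s" "separated (Field s)" "finite (Field s)"
    "card (Field s) < card (Field r)"
proof (cases "Total r")
  case True
  obtain b where b: "b \<in> Field r"
    using assms(4) by blast
  have "removable r b"
    using removable_if_total[OF True partial_order_onD(3)[OF assms(1)] b] .
  then have "poset_step r (delete r b)"
    unfolding poset_step_def deletion_step_def using Partial_order_delete[OF assms(1)] by blast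
  then show thesis
    using that assms b separated_subset[OF assms(3)]
    by (metis Field_delete Diff_subset card_Diff1_less finite_Diff)
next
  case False
  then obtain a b where ab: "a \<in> Field r" "b \<in> Field r" "a \<noteq> b" "(a, b) \<notin> r" "(b, a) \<notin> r"
    unfolding total_on_def by blast
  define M where "M = {|a, b|}"
  let ?s = "partially_linear_ext r M (fset M)"
  have M: "fset M \<subseteq> Field r" "M \<noteq> {||}" "card (fset M) = 2"
    using ab by (auto simp: M_def)
  have ac: "antichain r (fset M)"
    using ab by (auto simp: antichain_def M_def)
  have new: "Glued M \<notin> Field r"
    using Glued_notin_separated[OF assms(3) ab(1-3)] by (simp add: M_def)
  have F: "Field ?s = (Field r - fset M) \<union> {Glued M}"
    by (rule Field_partially_linear_ext[OF assms(1)])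
  have "Partial_order ?s"
    using Partial_order_partially_linear_ext[OF assms(1) ac _ new] by simp
  moreover have "ple_step r ?s"
    unfolding ple_step_def using ac M new by blast
  ultimately have "poset_step r ?s"
    unfolding poset_step_def by blast
  moreover have "separated (Field ?s)"
    unfolding F by (rule separated_Glued[OF assms(3) M(1,2)])
  \<comment> \<open>Two elements leave and one enters. \<open>card_mono\<close> gives at least two
    elements in \<open>Field r\<close>, so the subtraction on naturals is not truncated.\<close>
  moreover have "card (Field ?s) < card (Field r)"
    using card_mono[OF assms(2) M(1)] M new assms(2) by (simp add: F card_Diff_subset)
  ultimately show thesis
    using that assms(2) by (simp add: F)
qed

text \<open>Strong induction on the number of elements. The invariant \<open>separated\<close> is
  carried along because it guarantees that the next glued element is new.\<close>

lemma poset_steps_to_empty: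
  assumes "Partial_order r" "finite (Field r)" "separated (Field r)"
  shows "poset_step\<^sup>*\<^sup>* r {}"
  using assms
proof (induction "card (Field r)" arbitrary: r rule: less_induct)
  case less
  show ?case
  proof (cases "r = {}")
    case False
    then have "Field r \<noteq> {}"
      by (auto simp: Field_def)
    then obtain s where s: "poset_step r s" "separated (Field s)" "finite (Field s)"
      "card (Field s) < card (Field r)"
      using poset_step_decreasing less.prems by metis
    then have "poset_step\<^sup>*\<^sup>* s {}"
      using less.hyps unfolding poset_step_def by blast
    then show ?thesis
      using s(1) by (rule converse_rtranclp_into_rtranclp[rotated])
  qed simp
qed

text \<open>Gives access to the library facts on transporting an order along an injection.\<close>

lemma orig_poset_eq_dir_image: "orig_poset r = dir_image r Orig"
  unfolding orig_poset_def dir_image_def by force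

theorem theorem2p3:
  fixes P :: "'a rel"
  assumes "Partial_order P" and "finite (Field P)"
  shows "\<exists>(k :: nat) (Ps :: nat \<Rightarrow> 'a elt rel).
           Ps 0 = orig_poset P \<and> Ps k = {} \<and>
           (\<forall>i\<le>k. Partial_order (Ps i)) \<and>
           (\<forall>i<k. deletion_step (Ps i) (Ps (Suc i)) \<or> ple_step (Ps i) (Ps (Suc i)))"
proof -
  have po: "Partial_order (orig_poset P)"
    unfolding orig_poset_eq_dir_image
    by (rule Partial_order_dir_image[OF assms(1)]) (simp add: inj_on_def)
  have F: "Field (orig_poset P) = Orig ` Field P"
    unfolding orig_poset_eq_dir_image by (rule dir_image_Field)
  have "poset_step\<^sup>*\<^sup>* (orig_poset P) {}"
    using po assms(2) separated_Orig by (intro poset_steps_to_empty) (simp_all add: F)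
  then obtain k where "(poset_step ^^ k) (orig_poset P) {}"
    using rtranclp_imp_relpowp by metis
  then obtain Ps where Ps: "Ps 0 = orig_poset P" "Ps k = {}"
    "\<forall>i<k. poset_step (Ps i) (Ps (Suc i))"
    unfolding relpowp_fun_conv by blast
  \<comment> \<open>The poset at index 0 is covered by \<open>po\<close>; every later one is the
    target of a \<open>poset_step\<close>.\<close>
  have "Partial_order (Ps i)" if "i \<le> k" for i
    using that Ps po by (cases i) (auto simp: poset_step_def)
  then show ?thesis
    using Ps unfolding poset_step_def by blast
qed

end
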